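(* Let $G$ be any finite non-abelian group. Then the automata group $\mathcal G(\mathcal C(G))$ generated by the Cayley machine of $G$ does not embed in a wreath product $F\wr T$ of a finite group $F$ with a torsion-free group $T$.
   Context: Cayley machine: for a non-trivial finite group $G$, the Cayley machine $\mathcal C(G)$ is the automaton with state set $G$ and alphabet $G$ which, in state $g_0$ on reading input letter $g$, moves to state $g_0g$ and outputs $g_0g$. Each state $g\in G$ defines a bijection $\mathcal C(G)_g$ of the set $G^\omega$ of right-infinite words over $G$, namely $\mathcal C(G)_g(a_0,a_1,a_2,\ldots)=(ga_0,\,ga_0a_1,\,ga_0a_1a_2,\ldots)$. The automata group $\mathcal G(\mathcal C(G))$ is the group of bijections of $G^\omega$ generated by all $\mathcal C(G)_g$, $g\in G$, with product given by composition. Wreath products are restricted: $F\wr T=\left(\bigoplus_{T}F\right)\rtimes T$, with $T$ acting by shifting coordinates. *)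

theory Defs
  imports "HOL-Algebra.Algebra"
begin

section \<open>Mealy automata and the groups they generate\<close>

text \<open>Automata with equal input and output alphabet.\<close>

record ('s, 'a) mealy =
  states :: "'s set"
  alphabet :: "'a set"
  step :: "'s \<Rightarrow> 'a \<Rightarrow> 's"
  emit :: "'s \<Rightarrow> 'a \<Rightarrow> 'a"

definition infinite_words :: "'a set \<Rightarrow> (nat \<Rightarrow> 'a) set" where
  "infinite_words A = (UNIV \<rightarrow> A)"

primrec state_after :: "('s, 'a) mealy \<Rightarrow> 's \<Rightarrow> (nat \<Rightarrow> 'a) \<Rightarrow> nat \<Rightarrow> 's" where
  "state_after M q a 0 = q"
| "state_after M q a (Suc n) = step M (state_after M q a n) (a n)"

definition state_map :: "('s, 'a) mealy \<Rightarrow> 's \<Rightarrow> (nat \<Rightarrow> 'a) \<Rightarrow> (nat \<Rightarrow> 'a)" where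
  "state_map M q =
    (\<lambda>a\<in>infinite_words (alphabet M). \<lambda>n. emit M (state_after M q a n) (a n))"

text \<open>
  The library's \<open>subgroup_generated\<close> silently discards generators outside the carrier, so the
  following is meaningful only for automata all of whose states act bijectively;
  \<open>state_map_cayley_in_Bij\<close> below shows that Cayley machines are of this kind.
\<close>

definition automata_group :: "('s, 'a) mealy \<Rightarrow> ((nat \<Rightarrow> 'a) \<Rightarrow> (nat \<Rightarrow> 'a)) monoid" where
  "automata_group M =
    subgroup_generated (BijGroup (infinite_words (alphabet M))) (state_map M ` states M)"

definition cayley_machine :: "('a, 'm) monoid_scheme \<Rightarrow> ('a, 'a) mealy" where
  "cayley_machine G =
    \<lparr>states = carrier G, alphabet = carrier G,
     step = (\<lambda>g0 g. g0 \<otimes>\<^bsub>G\<^esub> g), emit = (\<lambda>g0 g. g0 \<otimes>\<^bsub>G\<^esub> g)\<rparr>"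

lemma state_map_cayley_0:
  assumes "a \<in> infinite_words (carrier G)"
  shows "state_map (cayley_machine G) g a 0 = g \<otimes>\<^bsub>G\<^esub> a 0"
  using assms by (simp add: state_map_def cayley_machine_def)

lemma state_map_cayley_Suc:
  assumes "a \<in> infinite_words (carrier G)"
  shows "state_map (cayley_machine G) g a (Suc n) =
    state_map (cayley_machine G) g a n \<otimes>\<^bsub>G\<^esub> a (Suc n)"
  using assms by (simp add: state_map_def cayley_machine_def)

lemma state_map_cayley_in_Bij:
  assumes "group G" and g: "g \<in> carrier G"
  shows "state_map (cayley_machine G) g \<in> Bij (infinite_words (carrier G))"
proof -
  interpret group G by fact
  let ?W = "infinite_words (carrier G)" and ?f = "state_map (cayley_machine G) g"
  define h where "h b n = (case n of 0 \<Rightarrow> inv\<^bsub>G\<^esub> g \<otimes>\<^bsub>G\<^esub> b 0 | Suc k \<Rightarrow> inv\<^bsub>G\<^esub> (b k) \<otimes>\<^bsub>G\<^esub> b (Suc k))" for b n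
  have W: "a n \<in> carrier G" if "a \<in> ?W" for a n
    using that by (auto simp: infinite_words_def)
  have f_closed: "?f a n \<in> carrier G" if a: "a \<in> ?W" for a n
    by (induction n) (auto simp: state_map_cayley_0 state_map_cayley_Suc a W g)
  have h_closed: "h b n \<in> carrier G" if "b \<in> ?W" for b n
    by (cases n) (auto simp: h_def W[OF that] g)
  have fW: "?f a \<in> ?W" if "a \<in> ?W" for a
    using f_closed[OF that] by (auto simp: infinite_words_def)
  have hW: "h b \<in> ?W" if "b \<in> ?W" for b
    using h_closed[OF that] by (auto simp: infinite_words_def)
  have hf: "h (?f a) = a" if a: "a \<in> ?W" for a
  proof
    fix n show "h (?f a) n = a n"
    proof (cases n)
      case 0
      then show ?thesis
        using W[OF a] g by (simp add: h_def state_map_cayley_0 a m_assoc[symmetric])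
    next
      case (Suc k)
      then show ?thesis
        using W[OF a] f_closed[OF a]
        by (simp add: h_def state_map_cayley_Suc a m_assoc[symmetric])
    qed
  qed
  have fh: "?f (h b) = b" if b: "b \<in> ?W" for b
  proof
    fix n show "?f (h b) n = b n"
    proof (induction n)
      case 0
      then show ?case
        using W[OF b] g
        by (simp add: state_map_cayley_0[OF hW[OF b]]) (simp add: h_def m_assoc[symmetric])
    next
      case (Suc n)
      then show ?case
        using W[OF b]
        by (simp add: state_map_cayley_Suc[OF hW[OF b]]) (simp add: h_def m_assoc[symmetric])
    qed
  qed
  have "bij_betw ?f ?W ?W"
    by (rule bij_betw_byWitness[where f' = h]) (auto simp: hf fh intro: fW hW)
  moreover have "?f \<in> extensional ?W"
    by (simp add: state_map_def cayley_machine_def)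
  ultimately show ?thesis by (simp add: Bij_def)
qed

lemma carrier_automata_group_cayley:
  assumes "group G"
  shows "carrier (automata_group (cayley_machine G)) =
    generate (BijGroup (infinite_words (carrier G))) (state_map (cayley_machine G) ` carrier G)"
proof -
  have "state_map (cayley_machine G) ` carrier G \<subseteq>
      carrier (BijGroup (infinite_words (carrier G)))"
    using state_map_cayley_in_Bij[OF assms] by (auto simp: BijGroup_def)
  then show ?thesis
    by (simp add: automata_group_def carrier_subgroup_generated cayley_machine_def Int_absorb1)
qed

section \<open>Restricted wreath products\<close>

text \<open>
  A pair \<open>(n, k)\<close> stands for \<open>n k\<close>, so that \<open>\<phi> k n = k n k\<inverse>\<close>. In the wreath product, \<open>t\<close> sends
  \<open>u\<close> to \<open>s \<mapsto> u (t\<inverse> s)\<close>, which makes the shift a left action, as \<open>wreath_shift_hom\<close> below confirms.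
  The library's \<open>sum_group\<close> consists of the finitely supported families.
\<close>

definition semidirect_product ::
    "('n, 'm) monoid_scheme \<Rightarrow> ('k, 'l) monoid_scheme \<Rightarrow> ('k \<Rightarrow> 'n \<Rightarrow> 'n) \<Rightarrow> ('n \<times> 'k) monoid" where
  "semidirect_product N K \<phi> =
    \<lparr>carrier = carrier N \<times> carrier K,
     monoid.mult = (\<lambda>(n, k) (n', k'). (n \<otimes>\<^bsub>N\<^esub> \<phi> k n', k \<otimes>\<^bsub>K\<^esub> k')),
     one = (\<one>\<^bsub>N\<^esub>, \<one>\<^bsub>K\<^esub>)\<rparr>"

definition wreath_base ::
    "('f, 'm) monoid_scheme \<Rightarrow> ('t, 'l) monoid_scheme \<Rightarrow> ('t \<Rightarrow> 'f) monoid" where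
  "wreath_base F T = sum_group (carrier T) (\<lambda>_. F)"

definition wreath_shift ::
    "('f, 'm) monoid_scheme \<Rightarrow> ('t, 'l) monoid_scheme \<Rightarrow> 't \<Rightarrow> ('t \<Rightarrow> 'f) \<Rightarrow> ('t \<Rightarrow> 'f)" where
  "wreath_shift F T t =
    (\<lambda>u\<in>carrier (wreath_base F T). \<lambda>s\<in>carrier T. u (inv\<^bsub>T\<^esub> t \<otimes>\<^bsub>T\<^esub> s))"

definition wreath_product ::
    "('f, 'm) monoid_scheme \<Rightarrow> ('t, 'l) monoid_scheme \<Rightarrow> (('t \<Rightarrow> 'f) \<times> 't) monoid" where
  "wreath_product F T = semidirect_product (wreath_base F T) T (wreath_shift F T)"

definition torsion_free :: "('t, 'l) monoid_scheme \<Rightarrow> bool" where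
  "torsion_free T \<longleftrightarrow>
    (\<forall>x\<in>carrier T. \<forall>n::nat. n > 0 \<longrightarrow> x [^]\<^bsub>T\<^esub> n = \<one>\<^bsub>T\<^esub> \<longrightarrow> x = \<one>\<^bsub>T\<^esub>)"

lemma group_semidirect_product:
  assumes "group N" "group K" and hom: "\<phi> \<in> hom K (AutoGroup N)"
  shows "group (semidirect_product N K \<phi>)"
proof -
  interpret N: group N by fact
  interpret K: group K by fact
  have aut: "\<phi> k \<in> auto N" if "k \<in> carrier K" for k
    using hom that by (auto simp: hom_def AutoGroup_def)
  have closed: "\<phi> k n \<in> carrier N" if "k \<in> carrier K" "n \<in> carrier N" for k n
    using aut[OF that(1)] that(2) by (auto simp: auto_def hom_def)
  have mult: "\<phi> k (n \<otimes>\<^bsub>N\<^esub> n') = \<phi> k n \<otimes>\<^bsub>N\<^esub> \<phi> k n'"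
    if "k \<in> carrier K" "n \<in> carrier N" "n' \<in> carrier N" for k n n'
    using aut[OF that(1)] that(2,3) by (auto simp: auto_def hom_def)
  have comp: "\<phi> (k \<otimes>\<^bsub>K\<^esub> k') n = \<phi> k (\<phi> k' n)"
    if "k \<in> carrier K" "k' \<in> carrier K" "n \<in> carrier N" for k k' n
    using hom aut[OF that(1)] aut[OF that(2)] that
    by (simp add: hom_def AutoGroup_def BijGroup_def auto_def compose_def)
  have one: "\<phi> \<one>\<^bsub>K\<^esub> n = n" if "n \<in> carrier N" for n
  proof -
    have "inj_on (\<phi> \<one>\<^bsub>K\<^esub>) (carrier N)"
      using aut[of "\<one>\<^bsub>K\<^esub>"] by (auto simp: auto_def Bij_def bij_betw_def)
    moreover have "\<phi> \<one>\<^bsub>K\<^esub> (\<phi> \<one>\<^bsub>K\<^esub> n) = \<phi> \<one>\<^bsub>K\<^esub> n"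
      using comp[of "\<one>\<^bsub>K\<^esub>" "\<one>\<^bsub>K\<^esub>" n] that by simp
    ultimately show ?thesis
      using that closed[of "\<one>\<^bsub>K\<^esub>" n] by (auto dest: inj_onD)
  qed
  have map_one: "\<phi> k \<one>\<^bsub>N\<^esub> = \<one>\<^bsub>N\<^esub>" if "k \<in> carrier K" for k
    using mult[OF that N.one_closed N.one_closed] closed[OF that N.one_closed] by simp
  show ?thesis
  proof (rule groupI)
    fix x assume "x \<in> carrier (semidirect_product N K \<phi>)"
    then obtain n k where x: "x = (n, k)" "n \<in> carrier N" "k \<in> carrier K"
      by (auto simp: semidirect_product_def)
    have "(\<phi> (inv\<^bsub>K\<^esub> k) (inv\<^bsub>N\<^esub> n), inv\<^bsub>K\<^esub> k) \<otimes>\<^bsub>semidirect_product N K \<phi>\<^esub> x =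
        \<one>\<^bsub>semidirect_product N K \<phi>\<^esub>"
      using x mult[of "inv\<^bsub>K\<^esub> k" "inv\<^bsub>N\<^esub> n" n] map_one[of "inv\<^bsub>K\<^esub> k"]
      by (simp add: semidirect_product_def)
    then show "\<exists>y\<in>carrier (semidirect_product N K \<phi>).
        y \<otimes>\<^bsub>semidirect_product N K \<phi>\<^esub> x = \<one>\<^bsub>semidirect_product N K \<phi>\<^esub>"
      by (rule bexI) (use x in \<open>simp add: semidirect_product_def closed\<close>)
  qed (auto simp: semidirect_product_def closed mult comp one N.m_assoc K.m_assoc)
qed

lemma wreath_shift_hom:
  assumes "group F" "group T"
  shows "wreath_shift F T \<in> hom T (AutoGroup (wreath_base F T))"
proof -
  interpret F: group F by fact
  interpret T: group T by fact
  let ?S = "wreath_base F T" and ?\<sigma> = "wreath_shift F T"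
  have S: "carrier ?S =
      {u \<in> carrier T \<rightarrow>\<^sub>E carrier F. finite {s \<in> carrier T. u s \<noteq> \<one>\<^bsub>F\<^esub>}}"
    by (simp add: wreath_base_def carrier_sum_group assms)
  have grp: "group ?S"
    by (simp add: wreath_base_def assms)
  have mult: "u \<otimes>\<^bsub>?S\<^esub> v = (\<lambda>s\<in>carrier T. u s \<otimes>\<^bsub>F\<^esub> v s)" for u v
    by (simp add: wreath_base_def)
  have app: "?\<sigma> t u = (\<lambda>s\<in>carrier T. u (inv\<^bsub>T\<^esub> t \<otimes>\<^bsub>T\<^esub> s))" if "u \<in> carrier ?S" for t u
    using that by (simp add: wreath_shift_def)
  have closed: "?\<sigma> t u \<in> carrier ?S" if t: "t \<in> carrier T" and u: "u \<in> carrier ?S" for t u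
  proof -
    have "{s \<in> carrier T. ?\<sigma> t u s \<noteq> \<one>\<^bsub>F\<^esub>} \<subseteq>
        (\<lambda>s. t \<otimes>\<^bsub>T\<^esub> s) ` {s \<in> carrier T. u s \<noteq> \<one>\<^bsub>F\<^esub>}"
    proof
      fix s assume "s \<in> {s \<in> carrier T. ?\<sigma> t u s \<noteq> \<one>\<^bsub>F\<^esub>}"
      then have "s = t \<otimes>\<^bsub>T\<^esub> (inv\<^bsub>T\<^esub> t \<otimes>\<^bsub>T\<^esub> s)"
          "inv\<^bsub>T\<^esub> t \<otimes>\<^bsub>T\<^esub> s \<in> {s \<in> carrier T. u s \<noteq> \<one>\<^bsub>F\<^esub>}"
        using t u by (auto simp: app T.m_assoc[symmetric])
      then show "s \<in> (\<lambda>s. t \<otimes>\<^bsub>T\<^esub> s) ` {s \<in> carrier T. u s \<noteq> \<one>\<^bsub>F\<^esub>}" by blast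
    qed
    moreover have "finite {s \<in> carrier T. u s \<noteq> \<one>\<^bsub>F\<^esub>}" using u by (simp add: S)
    ultimately have "finite {s \<in> carrier T. ?\<sigma> t u s \<noteq> \<one>\<^bsub>F\<^esub>}"
      using finite_surj by blast
    moreover have "u s \<in> carrier F" if "s \<in> carrier T" for s
      using u that by (auto simp: S)
    then have "?\<sigma> t u \<in> carrier T \<rightarrow>\<^sub>E carrier F"
      using t by (auto simp: app[OF u])
    ultimately show ?thesis by (simp add: S)
  qed
  have comp: "?\<sigma> (t \<otimes>\<^bsub>T\<^esub> t') u = ?\<sigma> t (?\<sigma> t' u)"
    if "t \<in> carrier T" "t' \<in> carrier T" "u \<in> carrier ?S" for t t' u
    using that closed
    by (auto simp: app fun_eq_iff T.inv_mult_group T.m_assoc)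
  have one: "?\<sigma> \<one>\<^bsub>T\<^esub> u = u" if "u \<in> carrier ?S" for u
  proof -
    have "u \<in> extensional (carrier T)" using that by (auto simp: S PiE_def)
    then show ?thesis
      by (auto simp: app[OF that] fun_eq_iff extensional_def)
  qed
  have hom: "?\<sigma> t \<in> hom ?S ?S" if t: "t \<in> carrier T" for t
  proof (rule homI)
    fix u v assume uv: "u \<in> carrier ?S" "v \<in> carrier ?S"
    then have "u \<otimes>\<^bsub>?S\<^esub> v \<in> carrier ?S" using grp by (simp add: group.subgroup_self subgroup.m_closed)
    then show "?\<sigma> t (u \<otimes>\<^bsub>?S\<^esub> v) = ?\<sigma> t u \<otimes>\<^bsub>?S\<^esub> ?\<sigma> t v"
      using t by (simp add: app uv) (auto simp: mult fun_eq_iff)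
  qed (rule closed[OF t])
  have bij: "bij_betw (?\<sigma> t) (carrier ?S) (carrier ?S)" if t: "t \<in> carrier T" for t
  proof (rule bij_betw_byWitness[where f' = "?\<sigma> (inv\<^bsub>T\<^esub> t)"])
    show "\<forall>u\<in>carrier ?S. ?\<sigma> (inv\<^bsub>T\<^esub> t) (?\<sigma> t u) = u"
      using comp[of "inv\<^bsub>T\<^esub> t" t] t one by simp
    show "\<forall>u\<in>carrier ?S. ?\<sigma> t (?\<sigma> (inv\<^bsub>T\<^esub> t) u) = u"
      using comp[of t "inv\<^bsub>T\<^esub> t"] t one by simp
  qed (use t closed in auto)
  have Bij: "?\<sigma> t \<in> Bij (carrier ?S)" if t: "t \<in> carrier T" for t
    using bij[OF t] by (simp add: Bij_def wreath_shift_def)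
  show ?thesis
  proof (rule homI)
    fix t t' assume t: "t \<in> carrier T" "t' \<in> carrier T"
    have "?\<sigma> (t \<otimes>\<^bsub>T\<^esub> t') = compose (carrier ?S) (?\<sigma> t) (?\<sigma> t')"
    proof (rule extensionalityI[of _ "carrier ?S"])
      show "?\<sigma> (t \<otimes>\<^bsub>T\<^esub> t') \<in> extensional (carrier ?S)" by (simp add: wreath_shift_def)
    qed (use t comp in \<open>auto simp: compose_def\<close>)
    then show "?\<sigma> (t \<otimes>\<^bsub>T\<^esub> t') = ?\<sigma> t \<otimes>\<^bsub>AutoGroup ?S\<^esub> ?\<sigma> t'"
      using Bij t by (simp add: AutoGroup_def BijGroup_def)
  qed (use hom Bij in \<open>simp add: AutoGroup_def auto_def\<close>)
qed

lemma group_wreath_product: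
  assumes "group F" "group T"
  shows "group (wreath_product F T)"
proof -
  have "group (wreath_base F T)"
    by (simp add: wreath_base_def assms)
  then show ?thesis
    unfolding wreath_product_def
    by (rule group_semidirect_product[OF _ assms(2) wreath_shift_hom[OF assms]])
qed

end

theory Submission
  imports Defs
begin

text \<open>
  Let \<open>x\<close> be the map of the state \<open>1\<close> and let \<open>D\<^sub>g\<close> multiply every letter on the left by \<open>g\<close>, so that
  the state \<open>g\<close> acts as \<open>D\<^sub>g x\<close>. As \<open>x\<close> fixes the first letter, every conjugate \<open>x\<^sup>n D\<^sub>g x\<^sup>-\<^sup>n\<close> multiplies
  the first letter by \<open>g\<close>, and hence never commutes with \<open>D\<^sub>h\<close> when \<open>g h \<noteq> h g\<close>. In a wreath product
  \<open>F \<wr> T\<close>, on the other hand, the images of the torsion elements \<open>D\<^sub>g\<close> and \<open>D\<^sub>h\<close> lie in the base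
  group, while the image of the element \<open>x\<close> of infinite order has a nontrivial shift \<open>s\<close>, because
  the base group has finite exponent. Conjugation by \<open>x\<^sup>n\<close> translates supports by \<open>s\<^sup>n\<close>, so for a
  suitable \<open>n\<close> the supports become disjoint and the two elements commute.
\<close>

section \<open>Wreath products of a finite group with a torsion-free group\<close>

lemma carrier_wreath_base:
  assumes "group F"
  shows "carrier (wreath_base F T) =
    {u \<in> carrier T \<rightarrow>\<^sub>E carrier F. finite {s \<in> carrier T. u s \<noteq> \<one>\<^bsub>F\<^esub>}}"
  by (simp add: wreath_base_def carrier_sum_group assms)

lemma carrier_wreath_product:
  "carrier (wreath_product F T) = carrier (wreath_base F T) \<times> carrier T"
  by (simp add: wreath_product_def semidirect_product_def)

text \<open>The hypothesis on \<open>fst z'\<close> matters because \<open>wreath_shift\<close> is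
  \<open>undefined\<close> outside the base group.\<close>

lemma fst_mult_wreath_product:
  assumes "snd z \<in> carrier T" "fst z' \<in> carrier (wreath_base F T)" "r \<in> carrier T"
  shows "fst (z \<otimes>\<^bsub>wreath_product F T\<^esub> z') r =
    fst z r \<otimes>\<^bsub>F\<^esub> fst z' (inv\<^bsub>T\<^esub> (snd z) \<otimes>\<^bsub>T\<^esub> r)"
  using assms
  by (cases z; cases z')
    (simp add: wreath_product_def semidirect_product_def wreath_base_def wreath_shift_def)

lemma snd_mult_wreath_product:
  "snd (z \<otimes>\<^bsub>wreath_product F T\<^esub> z') = snd z \<otimes>\<^bsub>T\<^esub> snd z'"
  by (simp add: wreath_product_def semidirect_product_def split: prod.splits)

lemma fst_one_wreath_product:
  "r \<in> carrier T \<Longrightarrow> fst \<one>\<^bsub>wreath_product F T\<^esub> r = \<one>\<^bsub>F\<^esub>"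
  by (simp add: wreath_product_def semidirect_product_def wreath_base_def)

lemma snd_one_wreath_product: "snd \<one>\<^bsub>wreath_product F T\<^esub> = \<one>\<^bsub>T\<^esub>"
  by (simp add: wreath_product_def semidirect_product_def)

lemma snd_pow_wreath_product:
  "snd (z [^]\<^bsub>wreath_product F T\<^esub> (n::nat)) = snd z [^]\<^bsub>T\<^esub> n"
  by (induction n) (simp_all add: snd_mult_wreath_product snd_one_wreath_product)

lemma wreath_product_eqI:
  assumes "group F" "z \<in> carrier (wreath_product F T)" "z' \<in> carrier (wreath_product F T)"
    and "\<And>r. r \<in> carrier T \<Longrightarrow> fst z r = fst z' r" "snd z = snd z'"
  shows "z = z'"
proof (rule prod_eqI)
  have "fst z \<in> extensional (carrier T)" "fst z' \<in> extensional (carrier T)"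
    using assms(1-3) by (auto simp: carrier_wreath_product carrier_wreath_base PiE_def)
  then show "fst z = fst z'" using assms(4) by (rule extensionalityI)
qed (fact assms(5))

section \<open>Torsion elements and the exponent of the base group\<close>

lemma torsion_wreath_product_snd:
  assumes "torsion_free T" "k \<in> carrier (wreath_product F T)"
    and "(N::nat) > 0" "k [^]\<^bsub>wreath_product F T\<^esub> N = \<one>\<^bsub>wreath_product F T\<^esub>"
  shows "snd k = \<one>\<^bsub>T\<^esub>"
proof -
  have "snd k [^]\<^bsub>T\<^esub> N = \<one>\<^bsub>T\<^esub>"
    using assms(4) by (metis snd_pow_wreath_product snd_one_wreath_product)
  then show ?thesis
    using assms by (auto simp: torsion_free_def carrier_wreath_product)
qed

text \<open>With trivial shift, powers are taken coordinatewise, and Lagrange's theorem in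
  \<open>F\<close> kills every coordinate with the same exponent. Read contrapositively, an element
  of infinite order has a nontrivial shift.\<close>

lemma wreath_base_pow_order:
  assumes "group F" "finite (carrier F)" "group T"
    and k: "k \<in> carrier (wreath_product F T)" "snd k = \<one>\<^bsub>T\<^esub>"
  shows "k [^]\<^bsub>wreath_product F T\<^esub> order F = \<one>\<^bsub>wreath_product F T\<^esub>"
proof -
  interpret F: group F by fact
  interpret T: group T by fact
  interpret W: group "wreath_product F T" by (rule group_wreath_product) fact+
  have base: "fst z \<in> carrier (wreath_base F T)" if "z \<in> carrier (wreath_product F T)" for z
    using that by (auto simp: carrier_wreath_product)
  have pow: "fst (k [^]\<^bsub>wreath_product F T\<^esub> n) r = fst k r [^]\<^bsub>F\<^esub> n"
    if r: "r \<in> carrier T" for n :: nat and r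
    by (induction n)
      (simp_all add: fst_one_wreath_product snd_pow_wreath_product fst_mult_wreath_product base k r)
  show ?thesis
  proof (rule wreath_product_eqI[OF \<open>group F\<close>])
    fix r assume r: "r \<in> carrier T"
    then have "fst k r \<in> carrier F"
      using base[OF k(1)] by (auto simp: carrier_wreath_base \<open>group F\<close>)
    then show "fst (k [^]\<^bsub>wreath_product F T\<^esub> order F) r = fst \<one>\<^bsub>wreath_product F T\<^esub> r"
      using r by (simp add: pow fst_one_wreath_product F.pow_order_eq_1)
  qed (use k in \<open>simp_all add: snd_pow_wreath_product snd_one_wreath_product\<close>)
qed

section \<open>Conjugation and supports\<close>

lemma snd_conj_wreath_product:
  assumes "group F" "group T"
    and z: "z \<in> carrier (wreath_product F T)"
    and k: "k \<in> carrier (wreath_product F T)" "snd k = \<one>\<^bsub>T\<^esub>"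
  shows "snd (z \<otimes>\<^bsub>wreath_product F T\<^esub> k \<otimes>\<^bsub>wreath_product F T\<^esub> inv\<^bsub>wreath_product F T\<^esub> z) = \<one>\<^bsub>T\<^esub>"
    (is "snd ?c = _")
proof -
  interpret T: group T by fact
  interpret W: group "wreath_product F T" by (rule group_wreath_product) fact+
  have c: "?c \<in> carrier (wreath_product F T)" using z k by simp
  \<comment> \<open>Multiplying the conjugate back by \<open>z\<close> avoids any formula for
    inverses in the wreath product.\<close>
  have "?c \<otimes>\<^bsub>wreath_product F T\<^esub> z = z \<otimes>\<^bsub>wreath_product F T\<^esub> k"
    using z k by (simp add: W.m_assoc)
  from arg_cong[OF this, of snd] have "snd ?c \<otimes>\<^bsub>T\<^esub> snd z = snd z \<otimes>\<^bsub>T\<^esub> snd k"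
    by (simp only: snd_mult_wreath_product)
  moreover have "snd ?c \<in> carrier T" "snd z \<in> carrier T"
    using c z by (auto simp only: carrier_wreath_product mem_Times_iff)
  ultimately show ?thesis using k by (simp add: T.r_cancel_one)
qed

text \<open>This is the inclusion of the support of the conjugate in the left translate by
  \<open>snd z\<close> of the support of \<open>k\<close>. It follows by comparing coordinate
  \<open>r\<close> in \<open>?c z = z k\<close>, where the trivial shift of \<open>?c\<close> leaves
  \<open>fst z r\<close> in place.\<close>

lemma fst_conj_wreath_product:
  assumes "group F" "group T"
    and z: "z \<in> carrier (wreath_product F T)"
    and k: "k \<in> carrier (wreath_product F T)" "snd k = \<one>\<^bsub>T\<^esub>"
    and r: "r \<in> carrier T" "fst k (inv\<^bsub>T\<^esub> (snd z) \<otimes>\<^bsub>T\<^esub> r) = \<one>\<^bsub>F\<^esub>"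
  shows "fst (z \<otimes>\<^bsub>wreath_product F T\<^esub> k \<otimes>\<^bsub>wreath_product F T\<^esub> inv\<^bsub>wreath_product F T\<^esub> z) r = \<one>\<^bsub>F\<^esub>"
    (is "fst ?c r = _")
proof -
  interpret F: group F by fact
  interpret T: group T by fact
  interpret W: group "wreath_product F T" by (rule group_wreath_product) fact+
  have c: "?c \<in> carrier (wreath_product F T)" using z k by simp
  have cz: "?c \<otimes>\<^bsub>wreath_product F T\<^esub> z = z \<otimes>\<^bsub>wreath_product F T\<^esub> k"
    using z k by (simp add: W.m_assoc)
  have base: "fst z \<in> carrier (wreath_base F T)" "snd z \<in> carrier T"
    if "z \<in> carrier (wreath_product F T)" for z
    using that by (auto simp: carrier_wreath_product)
  have val: "fst z r \<in> carrier F" if "z \<in> carrier (wreath_product F T)" for z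
    using base[OF that] r by (auto simp: carrier_wreath_base \<open>group F\<close>)
  have s: "snd ?c = \<one>\<^bsub>T\<^esub>" by (rule snd_conj_wreath_product) fact+
  have "fst (?c \<otimes>\<^bsub>wreath_product F T\<^esub> z) r = fst ?c r \<otimes>\<^bsub>F\<^esub> fst z r"
    by (subst fst_mult_wreath_product) (use s base[OF z] r in simp_all)
  moreover have "fst (z \<otimes>\<^bsub>wreath_product F T\<^esub> k) r = fst z r"
    by (subst fst_mult_wreath_product) (use base[OF z] base[OF k(1)] val[OF z] r in simp_all)
  ultimately show "fst ?c r = \<one>\<^bsub>F\<^esub>"
    using val[OF c] val[OF z] cz by (simp add: F.r_cancel_one)
qed

lemma (in group) inj_pow_torsion_free:
  assumes "torsion_free G" "s \<in> carrier G" "s \<noteq> \<one>"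
  shows "inj (\<lambda>n::nat. s [^] n)"
proof (rule linorder_injI)
  fix m n :: nat assume "m < n"
  show "s [^] m \<noteq> s [^] n"
  proof
    assume "s [^] m = s [^] n"
    then have "s [^] (n - m) = \<one>"
      using assms(2) by (simp add: pow_eq_div2)
    then show False
      using assms \<open>m < n\<close> unfolding torsion_free_def by (metis zero_less_diff)
  qed
qed

text \<open>The wreath product half of the contradiction: \<open>z\<close> will be the image of
  \<open>x\<close>, and \<open>k\<close>, \<open>k'\<close> the images of \<open>D\<^sub>g\<close>,
  \<open>D\<^sub>h\<close>, which share the exponent \<open>N\<close>.\<close>

lemma wreath_product_conj_commute:
  fixes F :: "('f, 'n) monoid_scheme" and T :: "('t, 'l) monoid_scheme"
  defines "W \<equiv> wreath_product F T"
  assumes "group F" "finite (carrier F)" "group T" "torsion_free T"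
    and z: "z \<in> carrier W" "\<And>m::nat. m > 0 \<Longrightarrow> z [^]\<^bsub>W\<^esub> m \<noteq> \<one>\<^bsub>W\<^esub>"
    and k: "k \<in> carrier W" "k [^]\<^bsub>W\<^esub> N = \<one>\<^bsub>W\<^esub>"
    and k': "k' \<in> carrier W" "k' [^]\<^bsub>W\<^esub> N = \<one>\<^bsub>W\<^esub>" and N: "(N::nat) > 0"
  obtains n :: nat where
    "(z [^]\<^bsub>W\<^esub> n \<otimes>\<^bsub>W\<^esub> k \<otimes>\<^bsub>W\<^esub> inv\<^bsub>W\<^esub> (z [^]\<^bsub>W\<^esub> n)) \<otimes>\<^bsub>W\<^esub> k' =
      k' \<otimes>\<^bsub>W\<^esub> (z [^]\<^bsub>W\<^esub> n \<otimes>\<^bsub>W\<^esub> k \<otimes>\<^bsub>W\<^esub> inv\<^bsub>W\<^esub> (z [^]\<^bsub>W\<^esub> n))"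
proof -
  interpret F: group F by fact
  interpret T: group T by fact
  interpret W: group W unfolding W_def by (rule group_wreath_product) fact+
  define s where "s = snd z"
  have base: "fst z \<in> carrier (wreath_base F T)" "snd z \<in> carrier T" if "z \<in> carrier W" for z
    using that by (auto simp: carrier_wreath_product W_def)
  have val: "fst z r \<in> carrier F" if "z \<in> carrier W" "r \<in> carrier T" for z r
    using base[OF that(1)] that by (auto simp: carrier_wreath_base \<open>group F\<close>)
  have fin: "finite {r \<in> carrier T. fst z r \<noteq> \<one>\<^bsub>F\<^esub>}" if "z \<in> carrier W" for z
    using base[OF that] by (auto simp: carrier_wreath_base \<open>group F\<close>)
  have sk: "snd k = \<one>\<^bsub>T\<^esub>" and sk': "snd k' = \<one>\<^bsub>T\<^esub>"
    using torsion_wreath_product_snd[OF \<open>torsion_free T\<close> _ N] k k' unfolding W_def by blast+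
  have s: "s \<in> carrier T" using base z by (simp add: s_def)
  have "order F > 0" using \<open>finite (carrier F)\<close> by (simp add: F.order_gt_0_iff_finite)
  \<comment> \<open>A trivial shift would make the positive power \<open>order F\<close> of
    \<open>z\<close> trivial.\<close>
  then have "s \<noteq> \<one>\<^bsub>T\<^esub>"
    using wreath_base_pow_order[OF \<open>group F\<close> \<open>finite (carrier F)\<close> \<open>group T\<close>] z
    unfolding W_def s_def by blast
  with s have inj: "inj (\<lambda>n::nat. s [^]\<^bsub>T\<^esub> n)"
    by (intro T.inj_pow_torsion_free \<open>torsion_free T\<close>)
  \<comment> \<open>The finitely many translations that carry some point of the support of
    \<open>k\<close> into the support of \<open>k'\<close>. The powers of \<open>s\<close> are
    pairwise distinct, so one of them lies outside.\<close>
  define Q where "Q = (\<lambda>(r, q). r \<otimes>\<^bsub>T\<^esub> inv\<^bsub>T\<^esub> q) `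
    ({r \<in> carrier T. fst k' r \<noteq> \<one>\<^bsub>F\<^esub>} \<times> {r \<in> carrier T. fst k r \<noteq> \<one>\<^bsub>F\<^esub>})"
  have "finite Q" unfolding Q_def using fin[OF k(1)] fin[OF k'(1)] by blast
  moreover have "infinite (range (\<lambda>n::nat. s [^]\<^bsub>T\<^esub> n))"
    using inj by (simp add: range_inj_infinite)
  ultimately obtain n :: nat where n: "s [^]\<^bsub>T\<^esub> n \<notin> Q"
    by (metis finite_subset image_subset_iff)
  define c where "c = z [^]\<^bsub>W\<^esub> n \<otimes>\<^bsub>W\<^esub> k \<otimes>\<^bsub>W\<^esub> inv\<^bsub>W\<^esub> (z [^]\<^bsub>W\<^esub> n)"
  have zn: "z [^]\<^bsub>W\<^esub> n \<in> carrier W" "snd (z [^]\<^bsub>W\<^esub> n) = s [^]\<^bsub>T\<^esub> n"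
    using z(1) by simp (simp add: W_def s_def snd_pow_wreath_product)
  have c: "c \<in> carrier W" using zn k by (simp add: c_def)
  have disj: "fst c r = \<one>\<^bsub>F\<^esub> \<or> fst k' r = \<one>\<^bsub>F\<^esub>" if r: "r \<in> carrier T" for r
  proof (rule disjCI)
    assume "fst k' r \<noteq> \<one>\<^bsub>F\<^esub>"
    \<comment> \<open>The coordinate that translation by \<open>s\<^sup>n\<close> moves to
      \<open>r\<close>. If \<open>k\<close> were nontrivial there, \<open>s\<^sup>n\<close> would
      lie in \<open>Q\<close>.\<close>
    define q where "q = inv\<^bsub>T\<^esub> (s [^]\<^bsub>T\<^esub> n) \<otimes>\<^bsub>T\<^esub> r"
    have q: "q \<in> carrier T" using s r by (simp add: q_def)
    have "s [^]\<^bsub>T\<^esub> n = r \<otimes>\<^bsub>T\<^esub> inv\<^bsub>T\<^esub> q"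
      using s r by (simp add: q_def T.inv_mult_group T.m_assoc[symmetric])
    with n q r \<open>fst k' r \<noteq> \<one>\<^bsub>F\<^esub>\<close> have "fst k q = \<one>\<^bsub>F\<^esub>"
      unfolding Q_def by force
    then show "fst c r = \<one>\<^bsub>F\<^esub>"
      using fst_conj_wreath_product[OF \<open>group F\<close> \<open>group T\<close> zn(1)[unfolded W_def]
          k(1)[unfolded W_def] sk r] zn(2)
      by (simp add: c_def W_def q_def)
  qed
  have sc: "snd c = \<one>\<^bsub>T\<^esub>"
    using snd_conj_wreath_product[OF \<open>group F\<close> \<open>group T\<close>] zn(1) k(1) sk
    unfolding c_def W_def by blast
  \<comment> \<open>Both shifts are trivial, so the products are coordinatewise, and by
    \<open>disj\<close> one of the two factors is trivial at each coordinate.\<close>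
  have "c \<otimes>\<^bsub>W\<^esub> k' = k' \<otimes>\<^bsub>W\<^esub> c"
  proof (rule wreath_product_eqI[OF \<open>group F\<close>, where T = T])
    fix r assume r: "r \<in> carrier T"
    show "fst (c \<otimes>\<^bsub>W\<^esub> k') r = fst (k' \<otimes>\<^bsub>W\<^esub> c) r"
      using disj[OF r] val[OF c r] val[OF k'(1) r] base[OF c] base[OF k'(1)] r sc sk'
      by (auto simp: W_def fst_mult_wreath_product)
  qed (use c k' sc sk' in \<open>simp_all add: W_def[symmetric] snd_mult_wreath_product[of F T, folded W_def]\<close>)
  then show thesis by (intro that[of n]) (simp add: c_def)
qed

section \<open>The automata group of a Cayley machine\<close>

lemma infinite_words_nth: "a \<in> infinite_words A \<Longrightarrow> a n \<in> A"
  by (auto simp: infinite_words_def)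

text \<open>The product of \<open>BijGroup\<close> is composition only on \<open>Bij\<close>, and
  \<open>compose\<close> is restricted to the set of words; hence the three hypotheses.\<close>

lemma mult_automata_group:
  assumes "\<phi> \<in> Bij (infinite_words (alphabet M))" "\<psi> \<in> Bij (infinite_words (alphabet M))"
    and "a \<in> infinite_words (alphabet M)"
  shows "(\<phi> \<otimes>\<^bsub>automata_group M\<^esub> \<psi>) a = \<phi> (\<psi> a)"
  using assms by (simp add: automata_group_def BijGroup_def compose_def)

lemma one_automata_group:
  "a \<in> infinite_words (alphabet M) \<Longrightarrow> \<one>\<^bsub>automata_group M\<^esub> a = a"
  by (simp add: automata_group_def BijGroup_def)

lemma carrier_automata_group_subset:
  "carrier (automata_group M) \<subseteq> Bij (infinite_words (alphabet M))"
  unfolding automata_group_def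
  using group.carrier_subgroup_generated_subset[OF group_BijGroup]
  by (fastforce simp: BijGroup_def)

lemma group_automata_group: "group (automata_group M)"
  unfolding automata_group_def by (intro group.group_subgroup_generated group_BijGroup)

section \<open>Letterwise multiplication and partial products\<close>

context group
begin

text \<open>The map \<open>D\<^sub>g\<close>; the restriction to words makes it extensional, as
  membership in \<open>Bij\<close> demands.\<close>

definition left_mult :: "'a \<Rightarrow> (nat \<Rightarrow> 'a) \<Rightarrow> (nat \<Rightarrow> 'a)" where
  "left_mult g = (\<lambda>a\<in>infinite_words (carrier G). \<lambda>n. g \<otimes> a n)"

abbreviation "words \<equiv> infinite_words (carrier G)"
abbreviation "AG \<equiv> automata_group (cayley_machine G)"
text \<open>The map \<open>x\<close>, which sends a word to the sequence of its partial
  products.\<close>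

abbreviation "shear \<equiv> state_map (cayley_machine G) \<one>"

lemma alphabet_cayley: "alphabet (cayley_machine G) = carrier G"
  by (simp add: cayley_machine_def)

lemmas carrier_AG = carrier_automata_group_subset[of "cayley_machine G", unfolded alphabet_cayley]
lemmas mult_AG = mult_automata_group[of _ "cayley_machine G", unfolded alphabet_cayley]
lemmas one_AG = one_automata_group[of _ "cayley_machine G", unfolded alphabet_cayley]

lemma AG_maps_words: "\<phi> \<in> carrier AG \<Longrightarrow> a \<in> words \<Longrightarrow> \<phi> a \<in> words"
  using carrier_AG by (auto simp: Bij_def bij_betw_def)

lemma left_mult_closed: "g \<in> carrier G \<Longrightarrow> a \<in> words \<Longrightarrow> left_mult g a \<in> words"
  by (auto simp: left_mult_def infinite_words_def)

lemma state_map_in_AG: "g \<in> carrier G \<Longrightarrow> state_map (cayley_machine G) g \<in> carrier AG"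
  by (subst carrier_automata_group_cayley) (auto intro: generate.incl)

lemma AG_eqI:
  assumes "\<phi> \<in> Bij words" "\<psi> \<in> Bij words" "\<And>a n. a \<in> words \<Longrightarrow> \<phi> a n = \<psi> a n"
  shows "\<phi> = \<psi>"
  by (rule extensionalityI[of _ words]) (use assms in \<open>auto simp: Bij_def\<close>)

lemma left_mult_Bij:
  assumes "g \<in> carrier G"
  shows "left_mult g \<in> Bij words"
proof -
  have inverse: "left_mult h (left_mult (inv h) a) = a" if "h \<in> carrier G" "a \<in> words" for h a
    using that left_mult_closed[of "inv h" a] infinite_words_nth[OF that(2)]
    by (auto simp: left_mult_def m_assoc[symmetric])
  have "bij_betw (left_mult g) words words"
    by (rule bij_betw_byWitness[where f' = "left_mult (inv g)"])
      (use assms inverse[of g] inverse[of "inv g"] left_mult_closed in auto)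
  then show ?thesis by (simp add: Bij_def left_mult_def)
qed

text \<open>By associativity, the leading \<open>g\<close> factors out of all partial products at
  once.\<close>

lemma left_mult_shear:
  assumes "g \<in> carrier G" "a \<in> words"
  shows "left_mult g (shear a) n = state_map (cayley_machine G) g a n"
proof -
  have [simp]: "shear a \<in> words"
    using AG_maps_words[OF state_map_in_AG] assms by simp
  have "g \<otimes> shear a n = state_map (cayley_machine G) g a n"
    by (induction n)
      (use assms infinite_words_nth[OF assms(2)] infinite_words_nth[OF \<open>shear a \<in> words\<close>] in
        \<open>simp_all add: state_map_cayley_0 state_map_cayley_Suc m_assoc[symmetric]\<close>)
  then show ?thesis by (simp add: left_mult_def)
qed

text \<open>By \<open>left_mult_shear\<close>, \<open>D\<^sub>g\<close> is the quotient of the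
  generators belonging to the states \<open>g\<close> and \<open>\<one>\<close>.\<close>

lemma left_mult_in_AG:
  assumes "g \<in> carrier G"
  shows "left_mult g \<in> carrier AG"
proof -
  interpret AG: group AG by (rule group_automata_group)
  let ?x = shear and ?c = "state_map (cayley_machine G) g"
  have x: "?x \<in> carrier AG" "?x \<in> Bij words" and c: "?c \<in> carrier AG"
    using assms carrier_AG by (auto intro!: state_map_in_AG)
  define d where "d = ?c \<otimes>\<^bsub>AG\<^esub> inv\<^bsub>AG\<^esub> ?x"
  have d: "d \<in> carrier AG" "d \<in> Bij words"
    using x c carrier_AG by (auto simp: d_def)
  have dx: "d \<otimes>\<^bsub>AG\<^esub> ?x = ?c" using x c by (simp add: d_def AG.m_assoc)
  have "left_mult g = d"
  proof (rule AG_eqI)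
    fix b n assume "b \<in> words"
    \<comment> \<open>Since \<open>x\<close> is onto, comparing at the words \<open>x a\<close>
      suffices, and the inverse of \<open>x\<close> never has to be evaluated.\<close>
    then obtain a where a: "a \<in> words" "b = ?x a"
      using x(2) by (auto simp: Bij_def bij_betw_def)
    then show "left_mult g b n = d b n"
      using left_mult_shear[OF assms] mult_AG[OF d(2) x(2)] dx by metis
  qed (use d assms left_mult_Bij in auto)
  then show ?thesis using d by simp
qed

text \<open>Since \<open>D\<close> turns products in \<open>G\<close> into composition, finite order
  passes from \<open>g\<close> to \<open>D\<^sub>g\<close>.\<close>

lemma left_mult_pow:
  assumes "g \<in> carrier G"
  shows "left_mult g [^]\<^bsub>AG\<^esub> (n::nat) = left_mult (g [^] n)"
proof -
  interpret AG: group AG by (rule group_automata_group)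
  have D: "left_mult h \<in> Bij words" "left_mult h \<in> carrier AG" if "h \<in> carrier G" for h
    using that by (auto intro: left_mult_Bij left_mult_in_AG)
  show ?thesis
  proof (induction n)
    case 0
    have "\<one>\<^bsub>AG\<^esub> = left_mult \<one>"
      by (rule AG_eqI)
        (use carrier_AG AG.one_closed D in \<open>auto simp: one_AG left_mult_def infinite_words_nth\<close>)
    then show ?case by simp
  next
    case (Suc n)
    have "left_mult (g [^] n) \<otimes>\<^bsub>AG\<^esub> left_mult g = left_mult (g [^] Suc n)"
    proof (rule AG_eqI)
      show "left_mult (g [^] n) \<otimes>\<^bsub>AG\<^esub> left_mult g \<in> Bij words"
        using AG.m_closed[OF D(2) D(2)] assms carrier_AG by blast
      fix a m assume "a \<in> words"
      then show "(left_mult (g [^] n) \<otimes>\<^bsub>AG\<^esub> left_mult g) a m = left_mult (g [^] Suc n) a m"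
        using assms left_mult_closed[of g a]
        by (simp add: mult_AG D) (simp add: left_mult_def m_assoc infinite_words_nth)
    qed (use assms D in simp)
    then show ?case using Suc by simp
  qed
qed

section \<open>Infinite order of \<open>shear\<close>\<close>

text \<open>The word \<open>x\<^sup>-\<^sup>k (g, 1, 1, \<dots>)\<close>, whose last nontrivial letter has index \<open>k\<close>.\<close>

primrec differences :: "'a \<Rightarrow> nat \<Rightarrow> nat \<Rightarrow> 'a" where
  "differences g 0 = (\<lambda>n. if n = 0 then g else \<one>)"
| "differences g (Suc k) =
    (\<lambda>n. case n of 0 \<Rightarrow> differences g k 0 | Suc m \<Rightarrow> inv (differences g k m) \<otimes> differences g k n)"

lemma differences_words:
  assumes "g \<in> carrier G"
  shows "differences g k \<in> words"
proof -
  have "differences g k n \<in> carrier G" for n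
    by (induction k arbitrary: n) (use assms in \<open>auto split: nat.split\<close>)
  then show ?thesis by (auto simp: infinite_words_def)
qed

lemma differences_beyond:
  "n > k \<Longrightarrow> differences g k n = \<one>"
  by (induction k arbitrary: n) (auto split: nat.split)

text \<open>Letter \<open>Suc k\<close> of row \<open>k\<close> is trivial, so passing to the next
  row just inverts the diagonal letter, which alternates between \<open>g\<close> and its
  inverse.\<close>

lemma differences_diagonal:
  assumes "g \<in> carrier G" "g \<noteq> \<one>"
  shows "differences g k k \<noteq> \<one>"
proof (induction k)
  case (Suc k)
  then show ?case
    using infinite_words_nth[OF differences_words[OF assms(1)]] by (simp add: differences_beyond)
qed (use assms in simp)

text \<open>The partial products of the successive quotients telescope.\<close>

lemma shear_differences:
  assumes "g \<in> carrier G"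
  shows "shear (differences g (Suc k)) = differences g k"
proof
  have w: "differences g j n \<in> carrier G" for j n
    using infinite_words_nth[OF differences_words[OF assms]] .
  show "shear (differences g (Suc k)) n = differences g k n" for n
    by (induction n)
      (simp_all add: state_map_cayley_0 state_map_cayley_Suc differences_words[OF assms] w
        m_assoc[symmetric] del: differences.simps, simp_all add: w m_assoc[symmetric])
qed

lemma shear_pow_neq_one:
  assumes "g \<in> carrier G" "g \<noteq> \<one>" "(m::nat) > 0"
  shows "shear [^]\<^bsub>AG\<^esub> m \<noteq> \<one>\<^bsub>AG\<^esub>"
proof
  interpret AG: group AG by (rule group_automata_group)
  have x: "shear [^]\<^bsub>AG\<^esub> n \<in> Bij words" "shear \<in> Bij words" for n :: nat
    using carrier_AG state_map_in_AG[of \<one>] by auto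
  \<comment> \<open>The innermost factor \<open>x\<close> acts first, lowering the row by one; the
    remaining power is handled by the induction hypothesis.\<close>
  have "(shear [^]\<^bsub>AG\<^esub> n) (differences g (n + j)) = differences g j" for n j :: nat
    by (induction n)
      (simp_all add: one_AG mult_AG x differences_words shear_differences assms
        del: differences.simps)
  moreover assume "shear [^]\<^bsub>AG\<^esub> m = \<one>\<^bsub>AG\<^esub>"
  ultimately have "differences g m = differences g 0"
    by (metis add.right_neutral one_AG differences_words assms(1))
  \<comment> \<open>Row \<open>0\<close> is trivial at every positive index, in particular at
    \<open>m\<close>.\<close>
  then have "differences g m m = \<one>" using assms(3) by simp
  then show False using differences_diagonal[OF assms(1,2)] by blast
qed

section \<open>Action on the first letter\<close>

text \<open>The first partial product is the first letter itself. The word varies in the induction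
  because the hypothesis is applied to \<open>shear a\<close>.\<close>

lemma shear_pow_head:
  assumes "a \<in> words"
  shows "(shear [^]\<^bsub>AG\<^esub> (n::nat)) a 0 = a 0"
  using assms
proof (induction n arbitrary: a)
  case (Suc n)
  interpret AG: group AG by (rule group_automata_group)
  have x: "shear [^]\<^bsub>AG\<^esub> n \<in> Bij words" "shear \<in> Bij words" "shear a \<in> words"
    using carrier_AG state_map_in_AG[of \<one>] AG_maps_words[OF _ Suc.prems] by auto
  then show ?case
    using Suc by (simp add: mult_AG state_map_cayley_0 infinite_words_nth)
qed (simp add: one_AG)

text \<open>Writing \<open>b = y a\<close> with \<open>y = x\<^sup>n\<close>, the conjugate sends
  \<open>b\<close> to \<open>y (D\<^sub>g a)\<close>, and \<open>y\<close> preserves first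
  letters.\<close>

lemma conj_left_mult_head:
  assumes "g \<in> carrier G" "b \<in> words"
  shows "(shear [^]\<^bsub>AG\<^esub> (n::nat) \<otimes>\<^bsub>AG\<^esub> left_mult g \<otimes>\<^bsub>AG\<^esub> inv\<^bsub>AG\<^esub> (shear [^]\<^bsub>AG\<^esub> n)) b 0 = g \<otimes> b 0"
proof -
  interpret AG: group AG by (rule group_automata_group)
  define y where "y = shear [^]\<^bsub>AG\<^esub> n"
  define p where "p = y \<otimes>\<^bsub>AG\<^esub> left_mult g \<otimes>\<^bsub>AG\<^esub> inv\<^bsub>AG\<^esub> y"
  have D: "left_mult g \<in> carrier AG" "left_mult g \<in> Bij words"
    using assms carrier_AG left_mult_in_AG by auto
  have y: "y \<in> carrier AG" "y \<in> Bij words"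
    using carrier_AG state_map_in_AG[of \<one>] by (auto simp: y_def)
  have p: "p \<in> carrier AG" "p \<in> Bij words"
    using carrier_AG y D by (auto simp: p_def)
  have py: "p \<otimes>\<^bsub>AG\<^esub> y = y \<otimes>\<^bsub>AG\<^esub> left_mult g"
    using y D by (simp add: p_def AG.m_assoc)
  obtain a where a: "a \<in> words" "b = y a"
    using y(2) assms(2) by (auto simp: Bij_def bij_betw_def)
  have "p b 0 = (p \<otimes>\<^bsub>AG\<^esub> y) a 0" using a p y by (simp add: mult_AG)
  also have "\<dots> = y (left_mult g a) 0" unfolding py using a D y by (simp add: mult_AG)
  also have "\<dots> = left_mult g a 0"
    unfolding y_def using assms a by (intro shear_pow_head left_mult_closed)
  also have "\<dots> = g \<otimes> b 0"
    using a shear_pow_head[of a n] by (simp add: left_mult_def y_def)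
  finally show ?thesis by (simp add: p_def y_def)
qed

lemma conj_left_mult_not_commute:
  fixes n :: nat
  assumes "g \<in> carrier G" "h \<in> carrier G" "g \<otimes> h \<noteq> h \<otimes> g"
  defines "p \<equiv> shear [^]\<^bsub>AG\<^esub> n \<otimes>\<^bsub>AG\<^esub> left_mult g \<otimes>\<^bsub>AG\<^esub> inv\<^bsub>AG\<^esub> (shear [^]\<^bsub>AG\<^esub> n)"
  shows "p \<otimes>\<^bsub>AG\<^esub> left_mult h \<noteq> left_mult h \<otimes>\<^bsub>AG\<^esub> p"
proof
  interpret AG: group AG by (rule group_automata_group)
  \<comment> \<open>On the constant word \<open>\<one>\<close>, the first letters of the two
    composites are \<open>g \<otimes> h\<close> and \<open>h \<otimes> g\<close>.\<close>
  let ?a = "\<lambda>_::nat. \<one>"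
  have a: "?a \<in> words" by (simp add: infinite_words_def)
  have p: "p \<in> carrier AG"
    using assms state_map_in_AG[of \<one>] left_mult_in_AG by (simp add: p_def)
  have Bij: "p \<in> Bij words" "left_mult h \<in> Bij words"
    using p carrier_AG assms left_mult_Bij by auto
  have head: "p b 0 = g \<otimes> b 0" if "b \<in> words" for b
    unfolding p_def by (rule conj_left_mult_head[OF assms(1) that])
  assume "p \<otimes>\<^bsub>AG\<^esub> left_mult h = left_mult h \<otimes>\<^bsub>AG\<^esub> p"
  then have "p (left_mult h ?a) 0 = left_mult h (p ?a) 0"
    using mult_AG[OF Bij a] mult_AG[OF Bij(2,1) a] by simp
  moreover have "p (left_mult h ?a) 0 = g \<otimes> h"
    using head[OF left_mult_closed[OF assms(2) a]] a assms by (simp add: left_mult_def)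
  moreover have "left_mult h (p ?a) 0 = h \<otimes> g"
    using head[OF a] AG_maps_words[OF p a] assms by (simp add: left_mult_def)
  ultimately show False using assms by simp
qed

end

section \<open>Incompatibility of the two commutation results under an embedding\<close>

theorem theorem1p3:
  fixes G :: "('a, 'm) monoid_scheme"
    and F :: "('f, 'n) monoid_scheme"
    and T :: "('t, 'l) monoid_scheme"
  assumes "group G" and "finite (carrier G)" and "\<not> comm_group G"
    and "group F" and "finite (carrier F)"
    and "group T" and "torsion_free T"
  shows "\<not> (\<exists>f. f \<in> mon (automata_group (cayley_machine G)) (wreath_product F T))"
proof
  interpret G: group G by fact
  let ?H = "automata_group (cayley_machine G)" and ?W = "wreath_product F T"
  let ?x = "state_map (cayley_machine G) \<one>\<^bsub>G\<^esub>"
  interpret W: group ?W by (rule group_wreath_product) fact+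
  interpret H: group ?H by (rule group_automata_group)
  assume "\<exists>f. f \<in> mon ?H ?W"
  then obtain f where hom: "f \<in> hom ?H ?W" and inj: "inj_on f (carrier ?H)"
    by (auto simp: mon_def)
  interpret f: group_hom ?H ?W f by unfold_locales (fact hom)
  obtain g h where gh: "g \<in> carrier G" "h \<in> carrier G" "g \<otimes>\<^bsub>G\<^esub> h \<noteq> h \<otimes>\<^bsub>G\<^esub> g"
    using \<open>\<not> comm_group G\<close> G.group_comm_groupI by blast
  \<comment> \<open>The identity commutes with \<open>h\<close>. A nontrivial element is what
    \<open>shear_pow_neq_one\<close> requires.\<close>
  then have "g \<noteq> \<one>\<^bsub>G\<^esub>" by auto
  let ?D = "G.left_mult" and ?N = "order G"
  have x: "?x \<in> carrier ?H" by (simp add: G.state_map_in_AG)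
  have N: "?N > 0" using \<open>finite (carrier G)\<close> by (simp add: G.order_gt_0_iff_finite)
  have D: "?D k \<in> carrier ?H" "f (?D k) [^]\<^bsub>?W\<^esub> ?N = \<one>\<^bsub>?W\<^esub>" if "k \<in> carrier G" for k
  proof -
    show "?D k \<in> carrier ?H" using that by (rule G.left_mult_in_AG)
    \<comment> \<open>The instance of \<open>left_mult_pow\<close> with exponent \<open>0\<close>
      identifies \<open>D\<close> at the identity of \<open>G\<close> with the identity of
      \<open>?H\<close>.\<close>
    moreover have "?D k [^]\<^bsub>?H\<^esub> ?N = \<one>\<^bsub>?H\<^esub>"
      using G.left_mult_pow[OF that, of ?N] G.left_mult_pow[OF G.one_closed, of 0] that
      by (simp add: G.pow_order_eq_1)
    ultimately show "f (?D k) [^]\<^bsub>?W\<^esub> ?N = \<one>\<^bsub>?W\<^esub>"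
      by (metis f.hom_nat_pow f.hom_one)
  qed
  \<comment> \<open>Injectivity of \<open>f\<close> keeps the order of \<open>x\<close> infinite in
    the wreath product.\<close>
  have fx: "f ?x [^]\<^bsub>?W\<^esub> m \<noteq> \<one>\<^bsub>?W\<^esub>" if "m > 0" for m :: nat
  proof
    assume "f ?x [^]\<^bsub>?W\<^esub> m = \<one>\<^bsub>?W\<^esub>"
    then have "f (?x [^]\<^bsub>?H\<^esub> m) = f \<one>\<^bsub>?H\<^esub>" using x by (simp add: f.hom_nat_pow)
    then have "?x [^]\<^bsub>?H\<^esub> m = \<one>\<^bsub>?H\<^esub>" 
      using inj x by (metis H.nat_pow_closed H.one_closed inj_onD)
    then show False using G.shear_pow_neq_one[OF gh(1) \<open>g \<noteq> \<one>\<^bsub>G\<^esub>\<close> that] by simp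
  qed
  obtain n :: nat where
    "(f ?x [^]\<^bsub>?W\<^esub> n \<otimes>\<^bsub>?W\<^esub> f (?D g) \<otimes>\<^bsub>?W\<^esub> inv\<^bsub>?W\<^esub> (f ?x [^]\<^bsub>?W\<^esub> n)) \<otimes>\<^bsub>?W\<^esub> f (?D h) =
      f (?D h) \<otimes>\<^bsub>?W\<^esub> (f ?x [^]\<^bsub>?W\<^esub> n \<otimes>\<^bsub>?W\<^esub> f (?D g) \<otimes>\<^bsub>?W\<^esub> inv\<^bsub>?W\<^esub> (f ?x [^]\<^bsub>?W\<^esub> n))"
    using wreath_product_conj_commute[OF assms(4-7) f.hom_closed[OF x] fx
        f.hom_closed[OF D(1)[OF gh(1)]] D(2)[OF gh(1)]
        f.hom_closed[OF D(1)[OF gh(2)]] D(2)[OF gh(2)] N] by blast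
  then have "f (?x [^]\<^bsub>?H\<^esub> n \<otimes>\<^bsub>?H\<^esub> ?D g \<otimes>\<^bsub>?H\<^esub> inv\<^bsub>?H\<^esub> (?x [^]\<^bsub>?H\<^esub> n) \<otimes>\<^bsub>?H\<^esub> ?D h) =
      f (?D h \<otimes>\<^bsub>?H\<^esub> (?x [^]\<^bsub>?H\<^esub> n \<otimes>\<^bsub>?H\<^esub> ?D g \<otimes>\<^bsub>?H\<^esub> inv\<^bsub>?H\<^esub> (?x [^]\<^bsub>?H\<^esub> n)))"
    using x D gh by (simp add: f.hom_nat_pow)
  \<comment> \<open>Injectivity pulls the commutation relation back to the automata group, where
    first letters refute it.\<close>
  then have "?x [^]\<^bsub>?H\<^esub> n \<otimes>\<^bsub>?H\<^esub> ?D g \<otimes>\<^bsub>?H\<^esub> inv\<^bsub>?H\<^esub> (?x [^]\<^bsub>?H\<^esub> n) \<otimes>\<^bsub>?H\<^esub> ?D h =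
      ?D h \<otimes>\<^bsub>?H\<^esub> (?x [^]\<^bsub>?H\<^esub> n \<otimes>\<^bsub>?H\<^esub> ?D g \<otimes>\<^bsub>?H\<^esub> inv\<^bsub>?H\<^esub> (?x [^]\<^bsub>?H\<^esub> n))"
    by (rule inj_onD[OF inj]) (use x D gh in simp_all)
  then show False using G.conj_left_mult_not_commute[OF gh] by blast
qed

end
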